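(* Let $k$ be a positive integer and let $G=(V,E)$ be a critically $k$-connected graph. Then $\tau(G)\ge \frac{|V|}{k+1}$.
   Context: A graph $G$ is critically $k$-connected if it is $k$-connected but $G-v$ is not $k$-connected for every vertex $v$ of $G$. A vertex cover of $G$ is a set of vertices meeting every edge; $\tau(G)$ is the minimum size of a vertex cover. *)

theory Defs
  imports Complex_Main "Graph_Theory.Digraph_Component"
begin

text \<open>
  A finite simple graph is an instance of the locale \<open>graph\<close> of \<open>Graph_Theory\<close>: a finite
  loop-free digraph without parallel arcs whose arc relation is symmetric, so that each edge
  is a pair of opposite arcs.
\<close>

text \<open>
  The usual convention: more than \<open>k\<close> vertices, and no set of fewer than \<open>k\<close> vertices
  separates the graph. In particular the complete graph on \<open>n\<close> vertices is \<open>k\<close>-connected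
  exactly for \<open>k < n\<close>. The bound on the number of vertices also makes the vertex set finite,
  so \<open>card S\<close> below is a genuine cardinality. The name \<open>connected\<close> is qualified to avoid the
  topological notion.
\<close>

definition k_connected :: "nat \<Rightarrow> ('a, 'b) pre_digraph \<Rightarrow> bool" where
  "k_connected k G \<longleftrightarrow>
     k < card (verts G) \<and>
     (\<forall>S \<subseteq> verts G. card S < k \<longrightarrow> Digraph_Component.connected (G \<restriction> (verts G - S)))"

definition critically_k_connected :: "nat \<Rightarrow> ('a, 'b) pre_digraph \<Rightarrow> bool" where
  "critically_k_connected k G \<longleftrightarrow>
     k_connected k G \<and> (\<forall>v \<in> verts G. \<not> k_connected k (pre_digraph.del_vert G v))"

definition vertex_cover :: "('a, 'b) pre_digraph \<Rightarrow> 'a set \<Rightarrow> bool" where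
  "vertex_cover G C \<longleftrightarrow> C \<subseteq> verts G \<and> (\<forall>e \<in> arcs G. tail G e \<in> C \<or> head G e \<in> C)"

text \<open>
  For a graph this is a minimum over a nonempty set (\<open>verts G\<close> is a vertex cover) of sizes of
  finite sets.
\<close>

definition vertex_cover_number :: "('a, 'b) pre_digraph \<Rightarrow> nat" where
  "vertex_cover_number G = (LEAST n. \<exists>C. vertex_cover G C \<and> card C = n)"

end

theory Submission
  imports Defs
begin

text \<open>
  Let \<open>C\<close> be a vertex cover of \<open>G = (V, E)\<close> and \<open>I = V - C\<close>, which is independent. Starting with
  \<open>X = {}\<close>, raise the connectivity of the graph induced on \<open>C \<union> X\<close> from \<open>j\<close> to \<open>j + 1\<close>, for
  \<open>j = 0, \<dots>, k - 1\<close>, by adding a minimal set \<open>Y \<subseteq> I - X\<close>. Every such \<open>Y\<close> has at most \<open>|C|\<close>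
  elements: each \<open>y \<in> Y\<close> lies in a cut of size \<open>j + 1\<close> containing no other element of \<open>Y\<close>; pick a
  neighbour of \<open>y\<close> on the smaller side of that cut. Uncrossing two such cuts, in the style of
  Mader's theorem on cycles of critical edges, shows that distinct elements of \<open>Y\<close> get distinct
  neighbours. Hence some \<open>X \<subseteq> I\<close> with \<open>|X| \<le> k |C|\<close> makes \<open>C \<union> X\<close> inseparable by fewer than \<open>k\<close>
  vertices. A vertex of \<open>I\<close> outside \<open>X\<close> could be deleted from \<open>G\<close>, because all vertices of \<open>I\<close>
  have at least \<open>k\<close> neighbours in \<open>C\<close>; so criticality gives \<open>X = I\<close>, unless \<open>|V| = k + 1\<close>.
\<close>

section \<open>Separations and cuts of a vertex set under an adjacency relation\<close>

text \<open>The cut itself stays implicit as \<open>W - (A \<union> B)\<close>, so passing to a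
  subset of \<open>W\<close> is just intersecting both sides with it.\<close>

definition separation :: "('a \<Rightarrow> 'a \<Rightarrow> bool) \<Rightarrow> 'a set \<Rightarrow> 'a set \<Rightarrow> 'a set \<Rightarrow> bool" where
  "separation E W A B \<longleftrightarrow>
     A \<noteq> {} \<and> B \<noteq> {} \<and> A \<inter> B = {} \<and> A \<union> B \<subseteq> W \<and> (\<forall>a\<in>A. \<forall>b\<in>B. \<not> E a b)"

text \<open>Connectivity without the bound on the number of vertices: cliques, even tiny or empty
  ones, qualify for every \<open>j\<close>.\<close>

definition inseparable :: "('a \<Rightarrow> 'a \<Rightarrow> bool) \<Rightarrow> nat \<Rightarrow> 'a set \<Rightarrow> bool" where
  "inseparable E j W \<longleftrightarrow> (\<forall>A B. separation E W A B \<longrightarrow> j \<le> card (W - (A \<union> B)))"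

lemma inseparableD:
  "inseparable E j W \<Longrightarrow> separation E W A B \<Longrightarrow> j \<le> card (W - (A \<union> B))"
  by (simp add: inseparable_def)

lemma inseparable_mono: "inseparable E k W \<Longrightarrow> j \<le> k \<Longrightarrow> inseparable E j W"
  by (meson inseparable_def le_trans)

lemma separation_restrict:
  assumes "separation E W' A B" "W \<subseteq> W'" "A \<inter> W \<noteq> {}" "B \<inter> W \<noteq> {}"
  shows "separation E W (A \<inter> W) (B \<inter> W)"
  using assms unfolding separation_def by blast

lemma separation_swap: "symp E \<Longrightarrow> separation E W A B \<Longrightarrow> separation E W B A"
  unfolding separation_def by (blast dest: sympD)

text \<open>A vertex \<open>u\<close> on a side that misses \<open>W\<close> has all its neighbours
  in \<open>W\<close> inside the cut, which makes the cut large. If both sides meet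
  \<open>W\<close>, the cut already separates \<open>W\<close>.\<close>

lemma inseparable_superset:
  assumes "symp E" "inseparable E k W" "W \<subseteq> W'" "finite W'"
    and deg: "\<And>u. u \<in> W' - W \<Longrightarrow> k \<le> card {x \<in> W. E u x}"
  shows "inseparable E k W'"
  unfolding inseparable_def
proof (intro allI impI)
  fix A B assume sep: "separation E W' A B"
  show "k \<le> card (W' - (A \<union> B))"
  proof (rule ccontr)
    assume less: "\<not> k \<le> card (W' - (A \<union> B))"
    have meets: "P \<inter> W \<noteq> {}" if sepP: "separation E W' P Q" and eq: "P \<union> Q = A \<union> B" for P Q
    proof
      assume disj: "P \<inter> W = {}"
      obtain u where u: "u \<in> P" using sepP by (auto simp: separation_def)
      have "{x \<in> W. E u x} \<subseteq> W' - (A \<union> B)"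
        using sepP u disj assms(3) unfolding eq[symmetric] separation_def by blast
      then have "card {x \<in> W. E u x} \<le> card (W' - (A \<union> B))"
        using assms(4) by (intro card_mono) auto
      moreover have "u \<in> W' - W" using u disj sepP by (auto simp: separation_def)
      ultimately show False using deg[of u] less by linarith
    qed
    have "separation E W (A \<inter> W) (B \<inter> W)"
      using separation_restrict[OF sep assms(3)] meets[OF sep]
        meets[OF separation_swap[OF assms(1) sep]] by blast
    from inseparableD[OF assms(2) this] have "k \<le> card (W - (A \<inter> W \<union> B \<inter> W))" .
    also have "\<dots> \<le> card (W' - (A \<union> B))"
      using assms(3,4) by (intro card_mono) auto
    finally show False using less by simp
  qed
qed

section \<open>Uncrossing two cuts\<close>

text \<open>Two separations split \<open>U\<close> into nine cells. The first four identities say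
  that the boundaries of opposite corners together have size
  \<open>card T1 + card T2\<close>.\<close>

lemma card_corner_boundaries:
  assumes "finite U" "A1 \<inter> B1 = {}" "A2 \<inter> B2 = {}"
    "A1 \<union> B1 \<subseteq> U" "A2 \<union> B2 \<subseteq> U" "T1 = U - (A1 \<union> B1)" "T2 = U - (A2 \<union> B2)"
  shows "card (T1 \<inter> A2 \<union> T1 \<inter> T2 \<union> T2 \<inter> A1) = card (T1 \<inter> A2) + card (T1 \<inter> T2) + card (T2 \<inter> A1)"
    and "card (T1 \<inter> B2 \<union> T1 \<inter> T2 \<union> T2 \<inter> B1) = card (T1 \<inter> B2) + card (T1 \<inter> T2) + card (T2 \<inter> B1)"
    and "card T1 = card (T1 \<inter> A2) + card (T1 \<inter> T2) + card (T1 \<inter> B2)"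
    and "card T2 = card (T2 \<inter> A1) + card (T1 \<inter> T2) + card (T2 \<inter> B1)"
    and "card A1 = card (A1 \<inter> A2) + card (T2 \<inter> A1) + card (A1 \<inter> B2)"
    and "card B2 = card (A1 \<inter> B2) + card (T1 \<inter> B2) + card (B1 \<inter> B2)"
proof -
  have three: "card (X \<union> Y \<union> Z) = card X + card Y + card Z"
    if "X \<subseteq> U" "Y \<subseteq> U" "Z \<subseteq> U" "X \<inter> Y = {}" "X \<inter> Z = {}" "Y \<inter> Z = {}" for X Y Z
  proof -
    have "finite X" "finite Y" "finite Z" using that assms(1) by (auto intro: finite_subset)
    then show ?thesis using that by (simp add: card_Un_disjoint Int_Un_distrib2)
  qed
  show "card (T1 \<inter> A2 \<union> T1 \<inter> T2 \<union> T2 \<inter> A1) = card (T1 \<inter> A2) + card (T1 \<inter> T2) + card (T2 \<inter> A1)"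
    using assms by (intro three) auto
  show "card (T1 \<inter> B2 \<union> T1 \<inter> T2 \<union> T2 \<inter> B1) = card (T1 \<inter> B2) + card (T1 \<inter> T2) + card (T2 \<inter> B1)"
    using assms by (intro three) auto
  have "T1 = T1 \<inter> A2 \<union> T1 \<inter> T2 \<union> T1 \<inter> B2" using assms by auto
  also have "card \<dots> = card (T1 \<inter> A2) + card (T1 \<inter> T2) + card (T1 \<inter> B2)"
    using assms by (intro three) auto
  finally show "card T1 = card (T1 \<inter> A2) + card (T1 \<inter> T2) + card (T1 \<inter> B2)" .
  have "T2 = T2 \<inter> A1 \<union> T1 \<inter> T2 \<union> T2 \<inter> B1" using assms by auto
  also have "card \<dots> = card (T2 \<inter> A1) + card (T1 \<inter> T2) + card (T2 \<inter> B1)"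
    using assms by (intro three) auto
  finally show "card T2 = card (T2 \<inter> A1) + card (T1 \<inter> T2) + card (T2 \<inter> B1)" .
  have "A1 = A1 \<inter> A2 \<union> T2 \<inter> A1 \<union> A1 \<inter> B2" using assms by auto
  also have "card \<dots> = card (A1 \<inter> A2) + card (T2 \<inter> A1) + card (A1 \<inter> B2)"
    using assms by (intro three) auto
  finally show "card A1 = card (A1 \<inter> A2) + card (T2 \<inter> A1) + card (A1 \<inter> B2)" .
  have "B2 = A1 \<inter> B2 \<union> T1 \<inter> B2 \<union> B1 \<inter> B2" using assms by auto
  also have "card \<dots> = card (A1 \<inter> B2) + card (T1 \<inter> B2) + card (B1 \<inter> B2)"
    using assms by (intro three) auto
  finally show "card B2 = card (A1 \<inter> B2) + card (T1 \<inter> B2) + card (B1 \<inter> B2)" .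
qed

text \<open>
  Here \<open>U\<close> is \<open>W\<close> together with the minimal extension, and \<open>T1\<close>, \<open>T2\<close> are the two cuts.
  The boundary of the corner \<open>A1 \<inter> A2\<close> contains both \<open>y1\<close> and \<open>y2\<close>. Its trace on \<open>W\<close> separates
  \<open>W\<close>, so the boundary has at least \<open>j + 2\<close> elements; by submodularity the boundary of the
  opposite corner \<open>B1 \<inter> B2\<close> has at most \<open>j\<close>, which forces that corner to be empty.
\<close>

lemma uncross_critical_separations:
  assumes "symp E" "finite U" "W \<subseteq> U" "inseparable E j W" "inseparable E (Suc j) U"
    and sep1: "separation E (U - {y1}) A1 B1" and sep2: "separation E (U - {y2}) A2 B2"
    and T1: "T1 = U - (A1 \<union> B1)" "card T1 = Suc j" "T1 - W = {y1}"
    and T2: "T2 = U - (A2 \<union> B2)" "card T2 = Suc j" "T2 - W = {y2}"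
    and "y1 \<noteq> y2" "c \<in> A1" "c \<in> A2" "c \<in> W" "E y1 c" "E y2 c"
    and "b \<in> B1" "b \<in> W" "E y1 b"
  shows "card B2 < card A1"
proof -
  define D where "D = T1 \<inter> A2 \<union> T1 \<inter> T2 \<union> T2 \<inter> A1"
  define D' where "D' = T1 \<inter> B2 \<union> T1 \<inter> T2 \<union> T2 \<inter> B1"
  note defs = D_def D'_def T1(1) T2(1)
  have s1: "A1 \<inter> B1 = {}" "A1 \<union> B1 \<subseteq> U" "\<And>a b. a \<in> A1 \<Longrightarrow> b \<in> B1 \<Longrightarrow> \<not> E a b \<and> \<not> E b a"
    using sep1 \<open>symp E\<close> unfolding separation_def by (blast dest: sympD)+
  have s2: "A2 \<inter> B2 = {}" "A2 \<union> B2 \<subseteq> U" "\<And>a b. a \<in> A2 \<Longrightarrow> b \<in> B2 \<Longrightarrow> \<not> E a b \<and> \<not> E b a"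
    using sep2 \<open>symp E\<close> unfolding separation_def by (blast dest: sympD)+
  note cards = card_corner_boundaries[OF \<open>finite U\<close> s1(1) s2(1) s1(2) s2(2) T1(1) T2(1)]
  have y1T: "y1 \<in> T1" "y1 \<notin> W" and y2T: "y2 \<in> T2" "y2 \<notin> W" using T1(3) T2(3) by auto
  have "y1 \<notin> T2" "y2 \<notin> T1" using T1(3) T2(3) \<open>y1 \<noteq> y2\<close> y1T(2) y2T(2) by auto
  \<comment> \<open>Outside \<open>T2\<close>, the vertex \<open>y1\<close> must lie on the side of
    its neighbour \<open>c\<close>; likewise for \<open>y2\<close> and \<open>T1\<close>.\<close>
  then have y1A: "y1 \<in> A2" and y2A: "y2 \<in> A1"
    using y1T y2T s1(3)[of c y2] s2(3)[of c y1] assms(15-) unfolding T1(1) T2(1) by auto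
  have finD: "finite D" "finite D'" using \<open>finite U\<close> unfolding defs by auto
  have "separation E W (A1 \<inter> A2 \<inter> W) (W - (A1 \<inter> A2) - D)"
    unfolding separation_def
  proof (intro conjI ballI)
    show "A1 \<inter> A2 \<inter> W \<noteq> {}" using assms by auto
    \<comment> \<open>The witness is \<open>b\<close>: \<open>D\<close> lies within
      \<open>T1 \<union> A1\<close>, which \<open>B1\<close> avoids.\<close>
    show "W - (A1 \<inter> A2) - D \<noteq> {}" using s1 \<open>b \<in> B1\<close> \<open>b \<in> W\<close> unfolding defs by blast
    fix p q assume "p \<in> A1 \<inter> A2 \<inter> W" "q \<in> W - (A1 \<inter> A2) - D"
    moreover from this have "q \<in> B1 \<or> q \<in> B2" using \<open>W \<subseteq> U\<close> unfolding defs by blast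
    ultimately show "\<not> E p q" using s1(3) s2(3) by blast
  qed auto
  from inseparableD[OF assms(4) this]
  have "j \<le> card (W - (A1 \<inter> A2 \<inter> W \<union> (W - (A1 \<inter> A2) - D)))" .
  also have "\<dots> \<le> card (D \<inter> W)" using finD by (intro card_mono) auto
  finally have jD: "j \<le> card (D \<inter> W)" .
  have "insert y1 (insert y2 (D \<inter> W)) \<subseteq> D"
    using y1T y2T y1A y2A unfolding D_def by auto
  then have "card (insert y1 (insert y2 (D \<inter> W))) \<le> card D" using finD by (intro card_mono)
  then have D2: "j + 2 \<le> card D" using jD y1T y2T \<open>y1 \<noteq> y2\<close> finD by simp
  have empty: "B1 \<inter> B2 = {}"
  proof (rule ccontr)
    assume ne: "B1 \<inter> B2 \<noteq> {}"
    have "separation E U (B1 \<inter> B2) (U - (B1 \<inter> B2) - D')"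
      unfolding separation_def
    proof (intro conjI ballI)
      show "U - (B1 \<inter> B2) - D' \<noteq> {}"
        using s1 s2 \<open>c \<in> A1\<close> \<open>c \<in> A2\<close> unfolding defs by blast
      fix p q assume "p \<in> B1 \<inter> B2" "q \<in> U - (B1 \<inter> B2) - D'"
      moreover from this have "q \<in> A1 \<or> q \<in> A2" unfolding defs by blast
      ultimately show "\<not> E p q" using s1(3) s2(3) by blast
    qed (use ne s1 s2 in auto)
    from inseparableD[OF assms(5) this]
    have "Suc j \<le> card (U - (B1 \<inter> B2 \<union> (U - (B1 \<inter> B2) - D')))" .
    also have "\<dots> \<le> card D'" using finD by (intro card_mono) auto
    finally show False using D2 cards(1-4) T1(2) T2(2) unfolding D_def D'_def by linarith
  qed
  \<comment> \<open>Since \<open>card D > card T1\<close>, the cell \<open>T2 \<inter> A1\<close> is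
    larger than \<open>T1 \<inter> B2\<close>. Adding \<open>A1 \<inter> B2\<close> to both compares
    \<open>A1\<close> with \<open>B2\<close>, whose third cell is empty.\<close>
  show ?thesis using D2 cards T1(2) T2(2) empty unfolding D_def D'_def by simp
qed

section \<open>Bounding minimal extensions\<close>

text \<open>Choosing for each \<open>y\<close> a neighbour on the smaller side of a cut through
  \<open>y\<close> gives an injection from \<open>Y\<close> into \<open>C\<close>.\<close>

lemma card_minimal_extension_le:
  assumes "symp E" "finite W" "finite Y" "C \<subseteq> W" "W \<inter> Y = {}"
    and nbr: "\<And>y x. y \<in> Y \<Longrightarrow> x \<in> W \<union> Y \<Longrightarrow> E y x \<Longrightarrow> x \<in> C"
    and insep: "inseparable E j W" "inseparable E (Suc j) (W \<union> Y)"
    and minimal: "\<And>y. y \<in> Y \<Longrightarrow> \<not> inseparable E (Suc j) (W \<union> Y - {y})"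
  shows "card Y \<le> card C"
proof -
  define U where "U = W \<union> Y"
  \<comment> \<open>The sides separate \<open>U - {y}\<close>, but the cut is taken in
    \<open>U\<close> and so contains \<open>y\<close>; this accounts for the size
    \<open>Suc j\<close>.\<close>
  define good where "good y A B \<longleftrightarrow> separation E (U - {y}) A B \<and> card (U - (A \<union> B)) = Suc j \<and>
    U - (A \<union> B) - W = {y} \<and> (\<exists>a\<in>A. a \<in> C \<and> E y a) \<and> (\<exists>b\<in>B. b \<in> C \<and> E y b)" for y A B
  have finU: "finite U" using assms by (simp add: U_def)
  have ex_good: "\<exists>A B. good y A B" if y: "y \<in> Y" for y
  proof -
    obtain A B where sep: "separation E (U - {y}) A B" and less: "card (U - {y} - (A \<union> B)) < Suc j"
      using minimal[OF y] unfolding inseparable_def U_def by (meson not_le)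
    have nbrs: "\<exists>p\<in>P. p \<in> C \<and> E y p"
      if sepP: "separation E (U - {y}) P Q" and eq: "P \<union> Q = A \<union> B" for P Q
    proof (rule ccontr)
      assume "\<not> ?thesis"
      \<comment> \<open>If \<open>y\<close> had no neighbour in \<open>P\<close>, it could join
        \<open>Q\<close>, leaving a cut of \<open>U\<close> that is too small.\<close>
      then have "separation E U P (insert y Q)"
        using sepP nbr[OF y] y \<open>symp E\<close> unfolding separation_def U_def by (blast dest: sympD)
      from inseparableD[OF insep(2)[folded U_def] this]
      have "Suc j \<le> card (U - (P \<union> insert y Q))" .
      also have "U - (P \<union> insert y Q) = U - {y} - (A \<union> B)" using eq by auto
      finally show False using less by simp
    qed
    have na: "\<exists>a\<in>A. a \<in> C \<and> E y a" and nb: "\<exists>b\<in>B. b \<in> C \<and> E y b"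
      using nbrs[OF sep] nbrs[OF separation_swap[OF \<open>symp E\<close> sep]] by auto
    have "W \<subseteq> U - {y}" using y assms by (auto simp: U_def)
    then have "separation E W (A \<inter> W) (B \<inter> W)"
      using separation_restrict[OF sep] na nb \<open>C \<subseteq> W\<close> by blast
    from inseparableD[OF insep(1) this]
    have "j \<le> card (W - (A \<inter> W \<union> B \<inter> W))" .
    also have "W - (A \<inter> W \<union> B \<inter> W) = (U - {y} - (A \<union> B)) \<inter> W" using y assms by (auto simp: U_def)
    \<comment> \<open>The cut without \<open>y\<close> has at most \<open>j\<close> elements and its
      trace on \<open>W\<close> at least \<open>j\<close>, so it lies in \<open>W\<close>.\<close>
    finally have "(U - {y} - (A \<union> B)) \<inter> W = U - {y} - (A \<union> B)"
      using less finU by (intro card_seteq) auto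
    moreover have "y \<in> U - (A \<union> B)" "y \<notin> W"
      using y sep assms by (auto simp: U_def separation_def)
    ultimately have "U - (A \<union> B) - W = {y}" by auto
    moreover have "card (U - {y} - (A \<union> B)) = j"
      using \<open>j \<le> card (W - (A \<inter> W \<union> B \<inter> W))\<close> less
        \<open>W - (A \<inter> W \<union> B \<inter> W) = _\<close> \<open>_ \<inter> W = U - {y} - (A \<union> B)\<close> by simp
    moreover have "U - (A \<union> B) = insert y (U - {y} - (A \<union> B))" using \<open>y \<in> U - (A \<union> B)\<close> by auto
    then have "card (U - (A \<union> B)) = Suc (card (U - {y} - (A \<union> B)))" using finU by simp
    ultimately show ?thesis using sep na nb unfolding good_def by blast
  qed
  have ex: "\<exists>A B. good y A B \<and> card A \<le> card B" if y: "y \<in> Y" for y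
  proof -
    obtain A B where "good y A B" using ex_good[OF y] by blast
    moreover from this have "good y B A"
      using separation_swap[OF \<open>symp E\<close>] unfolding good_def by (simp add: Un_commute)
    ultimately show ?thesis by (meson nat_le_linear)
  qed
  then obtain A B where AB: "\<And>y. y \<in> Y \<Longrightarrow> good y (A y) (B y)"
    "\<And>y. y \<in> Y \<Longrightarrow> card (A y) \<le> card (B y)" by metis
  then have "\<forall>y\<in>Y. \<exists>c. c \<in> A y \<and> c \<in> C \<and> E y c" unfolding good_def by blast
  then obtain c where c: "\<And>y. y \<in> Y \<Longrightarrow> c y \<in> A y \<and> c y \<in> C \<and> E y (c y)" by metis
  have less: "card (B y2) < card (A y1)"
    if y: "y1 \<in> Y" "y2 \<in> Y" "y1 \<noteq> y2" and eq: "c y1 = c y2" for y1 y2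
  proof -
    obtain b where b: "b \<in> B y1" "b \<in> W" "E y1 b" using AB(1)[OF y(1)] \<open>C \<subseteq> W\<close> unfolding good_def by blast
    show ?thesis
      using uncross_critical_separations[OF \<open>symp E\<close> finU _ insep(1) insep(2)[folded U_def],
          of y1 "A y1" "B y1" y2 "A y2" "B y2" _ _ "c y1" b]
        AB(1)[OF y(1)] AB(1)[OF y(2)] c[OF y(1)] c[OF y(2)] y eq b \<open>C \<subseteq> W\<close>
      unfolding good_def by (auto simp: U_def)
  qed
  have "inj_on c Y"
  proof (rule inj_onI, rule ccontr)
    fix y1 y2 assume y: "y1 \<in> Y" "y2 \<in> Y" "c y1 = c y2" "y1 \<noteq> y2"
    \<comment> \<open>Uncrossing in both orders closes a strict cycle:
      \<open>B y2 < A y1 \<le> B y1 < A y2 \<le> B y2\<close> in cardinalities.\<close>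
    then show False using less[OF y(1,2,4,3)] less[OF y(2,1) y(4,3)[symmetric]] AB(2)[OF y(1)] AB(2)[OF y(2)]
      by linarith
  qed
  moreover have "c ` Y \<subseteq> C" using c by blast
  ultimately show ?thesis using assms by (meson card_inj_on_le finite_subset)
qed

text \<open>Induction on \<open>k\<close>: each unit of connectivity costs at most
  \<open>card C\<close> further vertices.\<close>

lemma exists_small_inseparable:
  assumes "symp E" "finite V" "C \<subseteq> V" "inseparable E k V"
    and cover: "\<And>u v. u \<in> V - C \<Longrightarrow> v \<in> V \<Longrightarrow> E u v \<Longrightarrow> v \<in> C"
  shows "\<exists>X \<subseteq> V - C. card X \<le> k * card C \<and> inseparable E k (C \<union> X)"
  using assms(4)
proof (induction k)
  case 0
  show ?case by (intro exI[of _ "{}"]) (simp add: inseparable_def)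
next
  case (Suc j)
  obtain X where X: "X \<subseteq> V - C" "card X \<le> j * card C" "inseparable E j (C \<union> X)"
    using Suc.IH inseparable_mono[OF Suc.prems] by auto
  define F where "F Y \<longleftrightarrow> Y \<subseteq> V - C - X \<and> inseparable E (Suc j) (C \<union> X \<union> Y)" for Y
  have "C \<union> X \<union> (V - C - X) = V" using X assms by auto
  then have "F (V - C - X)" using Suc.prems by (simp add: F_def)
  \<comment> \<open>Least cardinality implies minimality under inclusion; a candidate exists because
    all of \<open>V\<close> is inseparable.\<close>
  then obtain Y where Y: "F Y" "\<And>Z. F Z \<Longrightarrow> card Y \<le> card Z"
    using ex_has_least_nat[of F _ card] by blast
  have fin: "finite X" "finite Y" "finite C"
    using Y(1) X(1) assms finite_subset[OF _ \<open>finite V\<close>] unfolding F_def by blast+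
  have "card Y \<le> card C"
  proof (rule card_minimal_extension_le[OF \<open>symp E\<close>, of "C \<union> X"])
    show "inseparable E j (C \<union> X)" by fact
    show "inseparable E (Suc j) (C \<union> X \<union> Y)" using Y(1) by (simp add: F_def)
    fix y assume y: "y \<in> Y"
    show "\<not> inseparable E (Suc j) (C \<union> X \<union> Y - {y})"
    proof
      assume "inseparable E (Suc j) (C \<union> X \<union> Y - {y})"
      moreover have "C \<union> X \<union> Y - {y} = C \<union> X \<union> (Y - {y})" using y Y(1) by (auto simp: F_def)
      ultimately have "F (Y - {y})" using Y(1) by (auto simp: F_def)
      then show False using Y(2) card_Diff1_less[OF fin(2) y] by fastforce
    qed
  next
    fix y x assume "y \<in> Y" "x \<in> C \<union> X \<union> Y" "E y x"
    then show "x \<in> C" using cover[of y x] Y(1) X(1) \<open>C \<subseteq> V\<close> by (auto simp: F_def)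
  qed (use fin Y(1) in \<open>auto simp: F_def\<close>)
  then have "card (X \<union> Y) \<le> Suc j * card C" using X(2) card_Un_le[of X Y] by simp
  moreover have "X \<union> Y \<subseteq> V - C" using X(1) Y(1) by (auto simp: F_def)
  ultimately show ?case using Y(1) unfolding F_def by (intro exI[of _ "X \<union> Y"]) (simp add: Un_assoc)
qed

text \<open>The neighbours of \<open>v\<close> cut it off from the rest; with fewer than
  \<open>k\<close> of them, \<open>k < card V\<close> leaves a vertex on the other side.\<close>

lemma inseparable_degree_ge:
  assumes "symp E" "finite V" "inseparable E k V" "k < card V" "v \<in> V" "\<not> E v v"
  shows "k \<le> card {x \<in> V. E v x}"
proof (rule ccontr)
  assume less: "\<not> k \<le> card {x \<in> V. E v x}"
  let ?N = "{x \<in> V. E v x}"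
  have "separation E V {v} (V - insert v ?N)"
  proof -
    have "card (insert v ?N) < card V" using less assms by (simp add: card_insert_if)
    then have "V - insert v ?N \<noteq> {}"
      using assms(2,5) by (metis (no_types, lifting) Diff_eq_empty_iff card_mono finite_insert finite_Collect_conjI
          finite_subset leD mem_Collect_eq subsetI)
    then show ?thesis using assms unfolding separation_def by auto
  qed
  from inseparableD[OF assms(3) this] have "k \<le> card (V - ({v} \<union> (V - insert v ?N)))" .
  also have "V - ({v} \<union> (V - insert v ?N)) = ?N" using assms by auto
  finally show False using less by simp
qed

lemma card_le_of_critically_inseparable:
  assumes "symp E" "finite V" "C \<subseteq> V" "inseparable E k V" "k < card V"
    and cover: "\<And>u v. u \<in> V - C \<Longrightarrow> v \<in> V \<Longrightarrow> E u v \<Longrightarrow> v \<in> C"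
    and critical: "\<And>v. v \<in> V \<Longrightarrow> \<not> inseparable E k (V - {v})"
  shows "card V \<le> (k + 1) * card C"
proof -
  have "\<exists>X \<subseteq> V - C. card X \<le> k * card C \<and> inseparable E k (C \<union> X)"
    by (rule exists_small_inseparable[OF assms(1-4)]) (rule cover)
  then obtain X where X: "X \<subseteq> V - C" "card X \<le> k * card C" "inseparable E k (C \<union> X)"
    by blast
  have "V - C \<subseteq> X"
  proof (rule subsetI, rule ccontr)
    fix v assume v: "v \<in> V - C" "v \<notin> X"
    have "k \<le> card {x \<in> C \<union> X. E u x}" if u: "u \<in> V - {v} - (C \<union> X)" for u
    proof -
      have "\<not> E u u" using u cover by auto
      then have "k \<le> card {x \<in> V. E u x}"
        using u inseparable_degree_ge[OF assms(1,2,4,5)] by auto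
      also have "\<dots> \<le> card {x \<in> C \<union> X. E u x}"
        using u cover X(1) assms(2,3) by (intro card_mono) (auto intro: finite_subset)
      finally show ?thesis .
    qed
    then have "inseparable E k (V - {v})"
      using X v assms(2,3) by (intro inseparable_superset[OF assms(1) X(3)]) auto
    then show False using critical v by auto
  qed
  then have "V = C \<union> X" using X assms(3) by auto
  then show ?thesis using X(2) card_Un_le[of C X] by simp
qed

section \<open>Translation from digraph connectivity\<close>

lemma mem_symcl_iff: "(u, v) \<in> R\<^sup>s \<longleftrightarrow> (u, v) \<in> R \<or> (v, u) \<in> R"
  by (auto simp: symcl_def)

text \<open>A path cannot leave a side of such a bipartition; conversely, the set reachable from
  \<open>u\<close> and its complement form one when some vertex is unreachable.\<close>

lemma (in wf_digraph) connected_iff_no_bipartition: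
  "Digraph_Component.connected G \<longleftrightarrow> verts G \<noteq> {} \<and>
     (\<nexists>A B. separation (\<lambda>u v. (u, v) \<in> (arcs_ends G)\<^sup>s) (verts G) A B \<and> A \<union> B = verts G)"
    (is "_ \<longleftrightarrow> _ \<and> (\<nexists>A B. separation ?E _ A B \<and> _)")
proof (intro iffI conjI notI; (elim conjE exE)?)
  assume conn: "Digraph_Component.connected G"
  then show "verts G = {} \<Longrightarrow> False" by (auto simp: connected_conv)
  fix A B assume sep: "separation ?E (verts G) A B" and AB: "A \<union> B = verts G"
  obtain a b where ab: "a \<in> A" "b \<in> B" using sep by (auto simp: separation_def)
  then have "(a, b) \<in> rtrancl_on (verts G) ((arcs_ends G)\<^sup>s)"
    using conn AB unfolding connected_conv by blast
  then have "b \<in> A"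
  proof (induction rule: rtrancl_on_induct)
    case base
    show ?case by fact
  next
    case (step v w)
    then show ?case using sep AB unfolding separation_def by blast
  qed
  then show False using ab sep by (auto simp: separation_def)
next
  assume ne: "verts G \<noteq> {}"
    and no: "\<nexists>A B. separation ?E (verts G) A B \<and> A \<union> B = verts G"
  have "(u, v) \<in> rtrancl_on (verts G) ((arcs_ends G)\<^sup>s)"
    if uv: "u \<in> verts G" "v \<in> verts G" for u v
  proof (rule ccontr)
    assume nr: "\<not> ?thesis"
    define A where "A = {x \<in> verts G. (u, x) \<in> rtrancl_on (verts G) ((arcs_ends G)\<^sup>s)}"
    have "separation ?E (verts G) A (verts G - A)"
      unfolding separation_def
    proof (intro conjI ballI notI)
      show "A = {} \<Longrightarrow> False" using uv by (auto simp: A_def)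
      show "verts G - A = {} \<Longrightarrow> False" using uv nr by (auto simp: A_def)
      fix a b assume "a \<in> A" "b \<in> verts G - A" "(a, b) \<in> (arcs_ends G)\<^sup>s"
      then show False by (auto simp: A_def intro: rtrancl_on_into_rtrancl_on)
    qed (auto simp: A_def)
    then show False using no by (auto simp: A_def)
  qed
  then show "Digraph_Component.connected G" using ne by (simp add: connected_conv)
qed

text \<open>Induced subgraphs inherit adjacency from \<open>G\<close>, so one relation serves for
  every removed set \<open>S\<close>, which becomes the implicit cut of a separation.\<close>

lemma (in fin_digraph) k_connected_iff_inseparable:
  "k_connected k G \<longleftrightarrow>
     k < card (verts G) \<and> inseparable (\<lambda>u v. (u, v) \<in> (arcs_ends G)\<^sup>s) k (verts G)"
    (is "_ \<longleftrightarrow> _ \<and> inseparable ?E _ _")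
proof -
  have conn: "Digraph_Component.connected (G \<restriction> (verts G - S)) \<longleftrightarrow> verts G - S \<noteq> {} \<and>
      (\<nexists>A B. separation ?E (verts G) A B \<and> S = verts G - (A \<union> B))" if S: "S \<subseteq> verts G" for S
  proof -
    interpret H: wf_digraph "G \<restriction> (verts G - S)" by (rule wellformed_induce_subgraph)
    have E: "(a, b) \<in> (arcs_ends (G \<restriction> (verts G - S)))\<^sup>s \<longleftrightarrow> ?E a b"
      if "a \<in> verts G - S" "b \<in> verts G - S" for a b
      using that by (auto simp: mem_symcl_iff arcs_ends_conv)
    have "separation (\<lambda>u v. (u, v) \<in> (arcs_ends (G \<restriction> (verts G - S)))\<^sup>s) (verts G - S) A B \<and>
        A \<union> B = verts G - S \<longleftrightarrow> separation ?E (verts G) A B \<and> S = verts G - (A \<union> B)" for A B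
      using E S unfolding separation_def by blast
    then show ?thesis unfolding H.connected_iff_no_bipartition by simp
  qed
  have ne: "verts G - S \<noteq> {}" if "k < card (verts G)" "S \<subseteq> verts G" "card S < k" for S
    using that by (metis Diff_eq_empty_iff order_less_asym subset_antisym)
  show ?thesis
  proof (cases "k < card (verts G)")
    case True
    then have "k_connected k G \<longleftrightarrow> (\<forall>S \<subseteq> verts G. card S < k \<longrightarrow>
        (\<nexists>A B. separation ?E (verts G) A B \<and> S = verts G - (A \<union> B)))"
      unfolding k_connected_def using conn ne by auto
    also have "\<dots> \<longleftrightarrow> inseparable ?E k (verts G)"
      unfolding inseparable_def by (metis Diff_subset not_le)
    finally show ?thesis using True by simp
  qed (simp add: k_connected_def)
qed

section \<open>The bound for vertex covers\<close>

lemma (in graph) card_verts_le_vertex_cover: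
  assumes "0 < k" "critically_k_connected k G" "vertex_cover G C"
  shows "card (verts G) \<le> (k + 1) * card C"
proof -
  let ?E = "\<lambda>u v. (u, v) \<in> (arcs_ends G)\<^sup>s"
  have symp: "symp ?E" by (auto simp: symp_def mem_symcl_iff)
  have C: "C \<subseteq> verts G" "finite C"
    using assms(3) finite_subset[OF _ finite_verts] by (auto simp: vertex_cover_def)
  have k: "k < card (verts G)" "inseparable ?E k (verts G)"
    using assms(2) by (auto simp: critically_k_connected_def k_connected_iff_inseparable)
  have cover: "v \<in> C" if "u \<in> verts G - C" "?E u v" for u v
    using that assms(3) by (auto simp: vertex_cover_def mem_symcl_iff arcs_ends_conv)
  show ?thesis
  \<comment> \<open>With exactly \<open>k + 1\<close> vertices, deleting one violates the size
    bound, so criticality yields no cut; a nonempty cover then suffices. Otherwise the failure must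
    come from a small cut.\<close>
  proof (cases "card (verts G) = k + 1")
    case True
    have "C \<noteq> {}"
    proof
      assume "C = {}"
      obtain v where v: "v \<in> verts G" using k by fastforce
      have "k \<le> card {x \<in> verts G. ?E v x}"
        using inseparable_degree_ge[OF symp _ k(2,1) v] cover[of v] v \<open>C = {}\<close> by auto
      moreover have "{x \<in> verts G. ?E v x} = {}" using cover[of v] v \<open>C = {}\<close> by auto
      ultimately show False using assms(1) by simp
    qed
    then have "1 \<le> card C" using C by (simp add: Suc_le_eq card_gt_0_iff)
    then show ?thesis using True mult_le_mono2[of 1 "card C" "k + 1"] by simp
  next
    case False
    show ?thesis
    proof (rule card_le_of_critically_inseparable[OF symp finite_verts C(1) k(2,1)])
      fix v assume v: "v \<in> verts G"
      interpret D: fin_digraph "del_vert v" by (rule fin_digraph_del_vert)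
      have "k < card (verts (del_vert v))" using False k v by (simp add: verts_del_vert)
      moreover have "\<not> k_connected k (del_vert v)"
        using assms(2) v by (auto simp: critically_k_connected_def)
      ultimately obtain A B where
        "separation (\<lambda>u w. (u, w) \<in> (arcs_ends (del_vert v))\<^sup>s) (verts G - {v}) A B"
        "card (verts G - {v} - (A \<union> B)) < k"
        unfolding D.k_connected_iff_inseparable inseparable_def by (auto simp: verts_del_vert not_le)
      moreover have "(a, b) \<in> (arcs_ends (del_vert v))\<^sup>s \<longleftrightarrow> ?E a b" if "a \<noteq> v" "b \<noteq> v" for a b
        using that by (auto simp: mem_symcl_iff arcs_ends_conv del_vert_simps)
      ultimately have "separation ?E (verts G - {v}) A B" unfolding separation_def by blast
      then show "\<not> inseparable ?E k (verts G - {v})"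
        using \<open>card _ < k\<close> inseparableD leD by blast
    qed (use cover in auto)
  qed
qed

theorem theorem6p2:
  fixes G :: "('a, 'b) pre_digraph" and k :: nat
  assumes "0 < k"
    and "graph G"
    and "critically_k_connected k G"
  shows "real (vertex_cover_number G) \<ge> real (card (verts G)) / (real k + 1)"
proof -
  interpret graph G by fact
  have "vertex_cover G (verts G)" by (auto simp: vertex_cover_def)
  then have "\<exists>C. vertex_cover G C \<and> card C = vertex_cover_number G"
    unfolding vertex_cover_number_def
    using LeastI_ex[of "\<lambda>n. \<exists>C. vertex_cover G C \<and> card C = n"] by blast
  then obtain C where "vertex_cover G C" "card C = vertex_cover_number G" by blast
  then have "card (verts G) \<le> (k + 1) * vertex_cover_number G"
    using card_verts_le_vertex_cover assms by metis
  then have "real (card (verts G)) \<le> real ((k + 1) * vertex_cover_number G)"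
    by (simp only: of_nat_le_iff)
  then show ?thesis by (simp add: divide_le_eq algebra_simps)
qed

end
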